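(* There is a universal constant $C>0$ such that the following holds. Let $d,\ell\ge 1$ be integers, let $x_1,\dots,x_\ell\in\mathbb{R}^d$, and set $P=\operatorname{conv}\{\pm x_1,\dots,\pm x_\ell\}\subset\mathbb{R}^d$ and $R=\max_{i\le \ell}\|x_i\|_2$. Then for all real $\rho\ge 1$ and $\eta\ge 0$, $$\gamma_d\bigl(\rho(P+\eta B_2^d)\bigr)\ \le\ \binom{\ell+d}{d}\Bigl(\frac{C\rho\,(R+\eta\sqrt d)}{d}\Bigr)^d.$$
   Context: $\gamma_d$ is the standard Gaussian measure on $\mathbb{R}^d$, $B_2^d$ is the closed Euclidean unit ball of $\mathbb{R}^d$, and $+$ between sets denotes Minkowski sum. *)

theory Defs
  imports "HOL-Probability.Probability"
begin

text \<open>
  The constant \<open>C\<close> has to be chosen before the dimension \<open>d\<close>, so \<open>d\<close> is a number and not a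
  type: a vector of \<open>\<real>\<^sup>d\<close> is a function \<open>nat \<Rightarrow> real\<close> with coordinates \<open>i < d\<close> that is
  \<^const>\<open>undefined\<close> elsewhere. This is exactly the space of the finite product measure
  below. The Euclidean norm of \<open>x\<close> is \<open>L2_set x {..<d}\<close>.
\<close>

definition vec_space :: "nat \<Rightarrow> (nat \<Rightarrow> real) set" where
  "vec_space d = ({..<d} \<rightarrow>\<^sub>E UNIV)"

definition vec_add :: "nat \<Rightarrow> (nat \<Rightarrow> real) \<Rightarrow> (nat \<Rightarrow> real) \<Rightarrow> (nat \<Rightarrow> real)" where
  "vec_add d x y = (\<lambda>i\<in>{..<d}. x i + y i)"

definition vec_scale :: "nat \<Rightarrow> real \<Rightarrow> (nat \<Rightarrow> real) \<Rightarrow> (nat \<Rightarrow> real)" where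
  "vec_scale d c x = (\<lambda>i\<in>{..<d}. c * x i)"

definition minkowski_sum :: "nat \<Rightarrow> (nat \<Rightarrow> real) set \<Rightarrow> (nat \<Rightarrow> real) set \<Rightarrow> (nat \<Rightarrow> real) set" where
  "minkowski_sum d A B = {vec_add d a b | a b. a \<in> A \<and> b \<in> B}"

definition unit_ball :: "nat \<Rightarrow> (nat \<Rightarrow> real) set" where
  "unit_ball d = {x \<in> vec_space d. L2_set x {..<d} \<le> 1}"

definition convex_set :: "nat \<Rightarrow> (nat \<Rightarrow> real) set \<Rightarrow> bool" where
  "convex_set d S \<longleftrightarrow> S \<subseteq> vec_space d \<and>
    (\<forall>x\<in>S. \<forall>y\<in>S. \<forall>u\<ge>0. \<forall>v\<ge>0. u + v = 1 \<longrightarrow>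
      vec_add d (vec_scale d u x) (vec_scale d v y) \<in> S)"

text \<open>Same construction as the library's \<open>convex hull S\<close>, meaningful for \<open>S \<subseteq> vec_space d\<close>.\<close>

definition convex_hull :: "nat \<Rightarrow> (nat \<Rightarrow> real) set \<Rightarrow> (nat \<Rightarrow> real) set" where
  "convex_hull d S = convex_set d hull S"

definition gaussian_measure :: "nat \<Rightarrow> (nat \<Rightarrow> real) measure" where
  "gaussian_measure d = Pi\<^sub>M {..<d} (\<lambda>_. density lborel std_normal_density)"

end

theory Submission
  imports Defs
begin

text \<open>
  The set \<open>\<rho>(P + \<eta>B)\<close> is covered by few small balls, by an argument of Maurey's type. Let \<open>V\<close> be
  the set of the at most \<open>2l\<close> points \<open>\<plusminus>x\<^sub>i\<close>, all of norm at most \<open>R\<close>. Every \<open>p \<in> P = conv V\<close> lies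
  within \<open>R / \<surd>d\<close> of the average of some \<open>d\<close> points of \<open>V\<close>, repetitions allowed
  (\<open>convex_hull_near_average\<close>). So \<open>\<rho>(P + \<eta>B)\<close> is contained in the union of balls of radius
  \<open>s = \<rho>(R / \<surd>d + \<eta>)\<close> whose centers are indexed by the multisets of size \<open>d\<close> over \<open>V\<close>, and there
  are at most \<open>(2l + d - 1 choose d) \<le> 2\<^sup>d (l + d choose d)\<close> of them (\<open>binomial_double_le\<close>).

  A ball of radius \<open>s\<close> in \<open>\<real>\<^sup>d\<close> has volume of order \<open>(s / \<surd>d)\<^sup>d\<close>, and its Gaussian measure
  is at most \<open>(\<surd>e s / \<surd>d)\<^sup>d\<close> wherever its center is (\<open>gaussian_measure_ball_le\<close>). Since
  \<open>s / \<surd>d = \<rho>(R + \<eta>\<surd>d) / d\<close>, the product of the two bounds is the claim with \<open>C = 2\<surd>e\<close>.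
  The choice of exactly \<open>d\<close> points balances the two factors: the number of centers costs only
  \<open>2\<^sup>d\<close> beyond the binomial coefficient, and the radius of approximation supplies the second
  factor \<open>1 / \<surd>d\<close>.
\<close>

section \<open>Gaussian measure of a small ball\<close>

definition euclidean_ball :: "nat \<Rightarrow> (nat \<Rightarrow> real) \<Rightarrow> real \<Rightarrow> (nat \<Rightarrow> real) set" where
  "euclidean_ball d z s = {y \<in> vec_space d. L2_set (\<lambda>i. y i - z i) {..<d} \<le> s}"

lemma std_normal_prob_space: "prob_space (density lborel std_normal_density)"
  by (rule prob_space_normal_density) simp

lemma prob_space_gaussian_measure: "prob_space (gaussian_measure d)"
  unfolding gaussian_measure_def by (intro prob_space_PiM std_normal_prob_space)

lemma space_gaussian_measure: "space (gaussian_measure d) = vec_space d"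
  by (simp add: gaussian_measure_def space_PiM vec_space_def)

lemma euclidean_ball_measurable: "euclidean_ball d z s \<in> sets (gaussian_measure d)"
proof -
  have "{y \<in> space (gaussian_measure d). L2_set (\<lambda>i. y i - z i) {..<d} \<le> s}
      \<in> sets (gaussian_measure d)"
    unfolding gaussian_measure_def L2_set_def by measurable
  then show ?thesis
    by (simp add: euclidean_ball_def space_gaussian_measure)
qed

text \<open>
  The one-dimensional factor in the exponential Markov bound for a ball: the standard density is
  at most \<open>1 / \<surd>(2\<pi>)\<close>, and what remains is an unnormalised normal density with mean \<open>z\<close> and
  standard deviation \<open>\<sigma>\<close>.
\<close>

lemma nn_integral_shifted_gaussian_le:
  fixes z \<sigma> :: real
  assumes "0 < \<sigma>"
  shows "(\<integral>\<^sup>+ t. ennreal (exp (1/2 - (t - z)\<^sup>2 / (2 * \<sigma>\<^sup>2))) \<partial>density lborel std_normal_density)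
    \<le> ennreal (exp (1/2) * \<sigma>)"
proof -
  have nd: "(\<integral>\<^sup>+ t. ennreal (normal_density z \<sigma> t) \<partial>lborel) = 1"
    by (subst nn_integral_eq_integral) (use assms in auto)
  have bound: "std_normal_density t * exp (1/2 - (t - z)\<^sup>2 / (2 * \<sigma>\<^sup>2))
      \<le> (exp (1/2) * \<sigma>) * normal_density z \<sigma> t" for t
  proof -
    have "std_normal_density t \<le> 1 / sqrt (2 * pi)"
      by (simp add: std_normal_density_def mult_left_le divide_right_mono)
    then have "std_normal_density t * exp (1/2 - (t - z)\<^sup>2 / (2 * \<sigma>\<^sup>2))
        \<le> 1 / sqrt (2 * pi) * exp (1/2 - (t - z)\<^sup>2 / (2 * \<sigma>\<^sup>2))"
      by (intro mult_right_mono) auto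
    also have "\<dots> = (exp (1/2) * \<sigma>) * normal_density z \<sigma> t"
      using assms exp_add[of "1/2" "- (t - z)\<^sup>2 / (2 * \<sigma>\<^sup>2)"]
      by (simp add: normal_density_def real_sqrt_mult)
    finally show ?thesis .
  qed
  have "(\<integral>\<^sup>+ t. ennreal (exp (1/2 - (t - z)\<^sup>2 / (2 * \<sigma>\<^sup>2))) \<partial>density lborel std_normal_density)
      = (\<integral>\<^sup>+ t. ennreal (std_normal_density t) * ennreal (exp (1/2 - (t - z)\<^sup>2 / (2 * \<sigma>\<^sup>2))) \<partial>lborel)"
    by (subst nn_integral_density) auto
  also have "\<dots> \<le> (\<integral>\<^sup>+ t. ennreal (exp (1/2) * \<sigma>) * ennreal (normal_density z \<sigma> t) \<partial>lborel)"
  proof (intro nn_integral_mono)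
    fix t
    show "ennreal (std_normal_density t) * ennreal (exp (1/2 - (t - z)\<^sup>2 / (2 * \<sigma>\<^sup>2)))
      \<le> ennreal (exp (1/2) * \<sigma>) * ennreal (normal_density z \<sigma> t)"
      using bound[of t] assms by (simp add: ennreal_mult[symmetric])
  qed
  also have "\<dots> = ennreal (exp (1/2) * \<sigma>)"
    by (subst nn_integral_cmult) (auto simp: nd)
  finally show ?thesis .
qed

text \<open>
  On the ball, \<open>exp ((s\<^sup>2 - \<parallel>y - z\<parallel>\<^sup>2) / (2\<sigma>\<^sup>2)) \<ge> 1\<close> for any \<open>\<sigma>\<close>, and this function is a product
  over the coordinates, so its integral against the product measure factors. The choice
  \<open>\<sigma> = s / \<surd>d\<close> minimises the resulting bound \<open>exp (s\<^sup>2 / (2\<sigma>\<^sup>2)) \<sigma>\<^sup>d\<close>.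
\<close>

lemma gaussian_measure_ball_le_pos:
  assumes "1 \<le> d" and "0 < s"
  shows "measure (gaussian_measure d) (euclidean_ball d z s) \<le> (exp (1/2) * s / sqrt (real d)) ^ d"
proof -
  define \<sigma> where "\<sigma> = s / sqrt (real d)"
  have \<sigma>: "0 < \<sigma>" using assms by (simp add: \<sigma>_def)
  have s2: "s\<^sup>2 = real d * \<sigma>\<^sup>2"
    using assms by (simp add: \<sigma>_def power_divide)
  define g where "g = (\<lambda>i t. ennreal (exp (1/2 - (t - z i)\<^sup>2 / (2 * \<sigma>\<^sup>2))))"
  let ?N = "\<lambda>_::nat. density lborel std_normal_density"
  interpret prob_space "gaussian_measure d" by (rule prob_space_gaussian_measure)
  interpret product_sigma_finite ?N
    by (simp add: product_sigma_finite_def prob_space_imp_sigma_finite std_normal_prob_space)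
  have ind: "indicator (euclidean_ball d z s) y \<le> (\<Prod>i<d. g i (y i))" for y
  proof (cases "y \<in> euclidean_ball d z s")
    case True
    then have "sqrt (\<Sum>i<d. (y i - z i)\<^sup>2) \<le> s"
      by (simp add: euclidean_ball_def L2_set_def)
    then have "(\<Sum>i<d. (y i - z i)\<^sup>2) \<le> real d * \<sigma>\<^sup>2"
      unfolding s2[symmetric] by (rule sqrt_le_D)
    then have "(\<Sum>i<d. (y i - z i)\<^sup>2 / (2 * \<sigma>\<^sup>2)) \<le> real d / 2"
      using \<sigma> by (simp add: sum_divide_distrib[symmetric] field_simps)
    then have "0 \<le> (\<Sum>i<d. 1/2 - (y i - z i)\<^sup>2 / (2 * \<sigma>\<^sup>2))"
      by (simp add: sum_subtractf)
    then have "1 \<le> (\<Prod>i<d. exp (1/2 - (y i - z i)\<^sup>2 / (2 * \<sigma>\<^sup>2)))"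
      by (simp add: exp_sum[symmetric])
    then show ?thesis
      using True by (simp add: g_def prod_ennreal)
  qed simp
  have "emeasure (gaussian_measure d) (euclidean_ball d z s)
      = (\<integral>\<^sup>+ y. indicator (euclidean_ball d z s) y \<partial>gaussian_measure d)"
    by (simp add: euclidean_ball_measurable)
  also have "\<dots> \<le> (\<integral>\<^sup>+ y. (\<Prod>i<d. g i (y i)) \<partial>gaussian_measure d)"
    by (intro nn_integral_mono ind)
  also have "\<dots> = (\<Prod>i<d. integral\<^sup>N (density lborel std_normal_density) (g i))"
    unfolding gaussian_measure_def
    by (rule product_nn_integral_prod) (auto simp: g_def)
  also have "\<dots> \<le> (\<Prod>i<d. ennreal (exp (1/2) * \<sigma>))"
    unfolding g_def by (intro prod_mono_ennreal nn_integral_shifted_gaussian_le \<sigma>)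
  also have "\<dots> = ennreal ((exp (1/2) * s / sqrt (real d)) ^ d)"
    using \<sigma> assms by (simp add: ennreal_power \<sigma>_def)
  finally show ?thesis
    using assms by (simp add: emeasure_eq_measure)
qed

text \<open>
  Radius \<open>0\<close> does occur, when all generators and \<open>\<eta>\<close> vanish; there \<open>\<sigma> = 0\<close> and the
  exponential bound is meaningless, so the estimate is obtained by letting the radius decrease to
  \<open>s\<close>.
\<close>

lemma gaussian_measure_ball_le:
  assumes "1 \<le> d" and "0 \<le> s"
  shows "measure (gaussian_measure d) (euclidean_ball d z s) \<le> (exp (1/2) * s / sqrt (real d)) ^ d"
proof (rule tendsto_lowerbound)
  show "((\<lambda>t. (exp (1/2) * t / sqrt (real d)) ^ d) \<longlongrightarrow> (exp (1/2) * s / sqrt (real d)) ^ d) (at_right s)"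
    using assms by (intro tendsto_intros) auto
  show "\<forall>\<^sub>F t in at_right s. measure (gaussian_measure d) (euclidean_ball d z s)
      \<le> (exp (1/2) * t / sqrt (real d)) ^ d"
  proof (rule eventually_at_rightI[of s "s + 1"])
    fix t assume t: "t \<in> {s<..<s+1}"
    interpret prob_space "gaussian_measure d" by (rule prob_space_gaussian_measure)
    have "measure (gaussian_measure d) (euclidean_ball d z s)
        \<le> measure (gaussian_measure d) (euclidean_ball d z t)"
      using t by (intro finite_measure_mono euclidean_ball_measurable) (auto simp: euclidean_ball_def)
    also have "\<dots> \<le> (exp (1/2) * t / sqrt (real d)) ^ d"
      using t assms by (intro gaussian_measure_ball_le_pos) auto
    finally show "measure (gaussian_measure d) (euclidean_ball d z s)
      \<le> (exp (1/2) * t / sqrt (real d)) ^ d" .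
  qed simp
qed simp

section \<open>Approximating a convex hull by averages of its generators\<close>

lemma convex_hull_subset_vec_space:
  assumes "V \<subseteq> vec_space d"
  shows "convex_hull d V \<subseteq> vec_space d"
  unfolding convex_hull_def
  by (rule hull_minimal[OF assms]) (auto simp: convex_set_def vec_space_def vec_add_def)

text \<open>
  A linear functional takes on \<open>V\<close> a value no larger than its value at a given point of the hull:
  the points \<open>q\<close> for which this holds form a set that contains \<open>V\<close> and is convex, because of two
  generators that serve two points, the one with the smaller value serves the whole segment.
\<close>

lemma convex_hull_generator_below:
  assumes V: "V \<subseteq> vec_space d" and p: "p \<in> convex_hull d V"
  obtains v where "v \<in> V" "(\<Sum>i<d. a i * v i) \<le> (\<Sum>i<d. a i * p i)"
proof -
  define T where "T = {q \<in> vec_space d. \<exists>v\<in>V. (\<Sum>i<d. a i * v i) \<le> (\<Sum>i<d. a i * q i)}"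
  have "convex_set d T"
    unfolding convex_set_def
  proof (intro conjI ballI allI impI)
    show "T \<subseteq> vec_space d" by (auto simp: T_def)
    fix x y and s t :: real
    assume x: "x \<in> T" and y: "y \<in> T" and st: "0 \<le> s" "0 \<le> t" "s + t = 1"
    from x obtain v where v: "v \<in> V" "(\<Sum>i<d. a i * v i) \<le> (\<Sum>i<d. a i * x i)"
      by (auto simp: T_def)
    from y obtain w where w: "w \<in> V" "(\<Sum>i<d. a i * w i) \<le> (\<Sum>i<d. a i * y i)"
      by (auto simp: T_def)
    define m where "m = min (\<Sum>i<d. a i * v i) (\<Sum>i<d. a i * w i)"
    obtain u where u: "u \<in> V" "m = (\<Sum>i<d. a i * u i)"
      using v(1) w(1) unfolding m_def min_def by metis
    have mx: "m \<le> (\<Sum>i<d. a i * x i)" and my: "m \<le> (\<Sum>i<d. a i * y i)"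
      using v(2) w(2) unfolding m_def by (simp_all add: min_le_iff_disj)
    have "m = s * m + t * m"
      using st(3) by (simp add: distrib_right[symmetric])
    also have "\<dots> \<le> s * (\<Sum>i<d. a i * x i) + t * (\<Sum>i<d. a i * y i)"
      by (intro add_mono mult_left_mono mx my st)
    also have "\<dots> = (\<Sum>i<d. s * (a i * x i) + t * (a i * y i))"
      by (simp only: sum_distrib_left sum.distrib)
    also have "\<dots> = (\<Sum>i<d. a i * vec_add d (vec_scale d s x) (vec_scale d t y) i)"
      by (intro sum.cong refl) (simp add: vec_add_def vec_scale_def algebra_simps)
    finally have "(\<Sum>i<d. a i * u i) \<le> (\<Sum>i<d. a i * vec_add d (vec_scale d s x) (vec_scale d t y) i)"
      by (simp only: u(2))
    moreover have "vec_add d (vec_scale d s x) (vec_scale d t y) \<in> vec_space d"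
      by (simp add: vec_add_def vec_space_def)
    ultimately show "vec_add d (vec_scale d s x) (vec_scale d t y) \<in> T"
      unfolding T_def using u(1) by blast
  qed
  moreover have "V \<subseteq> T" using V by (auto simp: T_def)
  ultimately have "convex_hull d V \<subseteq> T"
    unfolding convex_hull_def by (intro hull_minimal)
  then show ?thesis using p that by (auto simp: T_def)
qed

text \<open>
  A derandomised form of Maurey's lemma. In the usual proof the generators are drawn independently
  with mean \<open>p\<close>, and the variances add up. Here they are chosen one at a time: with \<open>S\<close> the
  current deviation from \<open>k p\<close>,
  \<open>\<parallel>S + v - p\<parallel>\<^sup>2 = \<parallel>S\<parallel>\<^sup>2 + 2\<langle>S - p, v - p\<rangle> + \<parallel>v\<parallel>\<^sup>2 - \<parallel>p\<parallel>\<^sup>2\<close>,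
  so a generator \<open>v\<close> with \<open>\<langle>S - p, v\<rangle> \<le> \<langle>S - p, p\<rangle>\<close> increases the squared deviation by at most
  \<open>\<parallel>v\<parallel>\<^sup>2 \<le> r\<close>.
\<close>

lemma convex_hull_greedy_sum:
  assumes V: "V \<subseteq> vec_space d" and p: "p \<in> convex_hull d V"
    and R: "\<And>v. v \<in> V \<Longrightarrow> (\<Sum>i<d. (v i)\<^sup>2) \<le> r"
  shows "\<exists>M\<in>multisets_of_size V k. (\<Sum>i<d. ((\<Sum>v\<in>#M. v i) - real k * p i)\<^sup>2) \<le> real k * r"
proof (induction k)
  case 0
  show ?case by simp
next
  case (Suc k)
  then obtain M where M: "M \<in> multisets_of_size V k"
    and le: "(\<Sum>i<d. ((\<Sum>v\<in>#M. v i) - real k * p i)\<^sup>2) \<le> real k * r"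
    by blast
  define S where "S = (\<lambda>i. (\<Sum>v\<in>#M. v i) - real k * p i)"
  obtain v where v: "v \<in> V" and below: "(\<Sum>i<d. (S i - p i) * v i) \<le> (\<Sum>i<d. (S i - p i) * p i)"
    by (rule convex_hull_generator_below[OF V p])
  have "(\<Sum>i<d. ((\<Sum>w\<in>#add_mset v M. w i) - real (Suc k) * p i)\<^sup>2) = (\<Sum>i<d. (S i + v i - p i)\<^sup>2)"
    by (simp add: S_def algebra_simps)
  also have "\<dots> = (\<Sum>i<d. (S i)\<^sup>2 + 2 * ((S i - p i) * v i) - 2 * ((S i - p i) * p i) + (v i)\<^sup>2 - (p i)\<^sup>2)"
    by (simp add: power2_eq_square algebra_simps)
  also have "\<dots> = (\<Sum>i<d. (S i)\<^sup>2) + 2 * (\<Sum>i<d. (S i - p i) * v i) - 2 * (\<Sum>i<d. (S i - p i) * p i)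
      + (\<Sum>i<d. (v i)\<^sup>2) - (\<Sum>i<d. (p i)\<^sup>2)"
    by (simp add: sum.distrib sum_subtractf sum_distrib_left)
  also have "\<dots> \<le> real k * r + r"
    using below R[OF v] le sum_nonneg[of "{..<d}" "\<lambda>i. (p i)\<^sup>2"] by (simp add: S_def)
  also have "\<dots> = real (Suc k) * r" by (simp add: algebra_simps)
  finally show ?case
    using M v by (intro bexI[of _ "add_mset v M"]) (auto simp: multisets_of_size_def)
qed

lemma convex_hull_near_average:
  assumes V: "V \<subseteq> vec_space d" and p: "p \<in> convex_hull d V"
    and R: "\<And>v. v \<in> V \<Longrightarrow> L2_set v {..<d} \<le> R" and k: "1 \<le> k"
  obtains M where "M \<in> multisets_of_size V k"
    "L2_set (\<lambda>i. p i - (\<Sum>v\<in>#M. v i) / real k) {..<d} \<le> R / sqrt (real k)"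
proof -
  obtain w where "w \<in> V"
    by (rule convex_hull_generator_below[OF V p])
  then have R0: "0 \<le> R" using R[of w] L2_set_nonneg[of w "{..<d}"] by linarith
  have "(\<Sum>i<d. (v i)\<^sup>2) \<le> R\<^sup>2" if "v \<in> V" for v
    using R[OF that] by (simp add: L2_set_def sqrt_le_D)
  from convex_hull_greedy_sum[OF V p this, of k] obtain M where M: "M \<in> multisets_of_size V k"
    and le: "(\<Sum>i<d. ((\<Sum>v\<in>#M. v i) - real k * p i)\<^sup>2) \<le> real k * R\<^sup>2"
    by blast
  have "L2_set (\<lambda>i. p i - (\<Sum>v\<in>#M. v i) / real k) {..<d}
      = L2_set (\<lambda>i. 1 / real k * ((\<Sum>v\<in>#M. v i) - real k * p i)) {..<d}"
    unfolding L2_set_def using k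
    by (intro arg_cong[where f = sqrt] sum.cong refl, subst power2_commute) (simp add: field_simps)
  also have "\<dots> = 1 / real k * L2_set (\<lambda>i. (\<Sum>v\<in>#M. v i) - real k * p i) {..<d}"
    by (rule L2_set_right_distrib[symmetric]) simp
  also have "\<dots> \<le> 1 / real k * (sqrt (real k) * R)"
    using le R0 unfolding L2_set_def
    by (intro mult_left_mono) (auto dest: real_sqrt_le_mono simp: real_sqrt_mult)
  also have "\<dots> = R / sqrt (real k)"
    using k by (simp add: field_simps)
  finally show ?thesis using that M by blast
qed

section \<open>Covering and counting\<close>

text \<open>
  The summand \<open>\<eta>B\<close> needs no covering of its own: it only enlarges the radius of the balls that
  cover the hull.
\<close>

lemma scaled_minkowski_sum_covered:
  assumes V: "V \<subseteq> vec_space d" and R: "\<And>v. v \<in> V \<Longrightarrow> L2_set v {..<d} \<le> R"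
    and d: "1 \<le> d" and "0 \<le> \<rho>" "0 \<le> \<eta>"
  shows "vec_scale d \<rho> ` minkowski_sum d (convex_hull d V) (vec_scale d \<eta> ` unit_ball d)
    \<subseteq> (\<Union>M\<in>multisets_of_size V d.
          euclidean_ball d (\<lambda>i. \<rho> * ((\<Sum>v\<in>#M. v i) / real d)) (\<rho> * (R / sqrt (real d) + \<eta>)))"
proof
  fix y assume "y \<in> vec_scale d \<rho> ` minkowski_sum d (convex_hull d V) (vec_scale d \<eta> ` unit_ball d)"
  then obtain p b where p: "p \<in> convex_hull d V" and b: "b \<in> unit_ball d"
    and y: "y = vec_scale d \<rho> (vec_add d p (vec_scale d \<eta> b))"
    by (auto simp: minkowski_sum_def)
  obtain M where M: "M \<in> multisets_of_size V d"
    and near: "L2_set (\<lambda>i. p i - (\<Sum>v\<in>#M. v i) / real d) {..<d} \<le> R / sqrt (real d)"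
    using convex_hull_near_average[OF V p R d] by blast
  let ?c = "\<lambda>i. (\<Sum>v\<in>#M. v i) / real d"
  have "L2_set (\<lambda>i. y i - \<rho> * ?c i) {..<d} = L2_set (\<lambda>i. \<rho> * ((p i - ?c i) + \<eta> * b i)) {..<d}"
    by (intro L2_set_cong refl) (simp add: y vec_scale_def vec_add_def algebra_simps)
  also have "\<dots> = \<rho> * L2_set (\<lambda>i. (p i - ?c i) + \<eta> * b i) {..<d}"
    using assms by (simp add: L2_set_right_distrib)
  also have "\<dots> \<le> \<rho> * (L2_set (\<lambda>i. p i - ?c i) {..<d} + L2_set (\<lambda>i. \<eta> * b i) {..<d})"
    using assms by (intro mult_left_mono L2_set_triangle_ineq)
  also have "\<dots> = \<rho> * (L2_set (\<lambda>i. p i - ?c i) {..<d} + \<eta> * L2_set b {..<d})"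
    using assms by (simp add: L2_set_right_distrib)
  also have "\<dots> \<le> \<rho> * (R / sqrt (real d) + \<eta>)"
    using assms near b
    by (intro mult_left_mono add_mono) (auto simp: unit_ball_def intro: mult_left_le)
  finally have "y \<in> euclidean_ball d (\<lambda>i. \<rho> * ?c i) (\<rho> * (R / sqrt (real d) + \<eta>))"
    by (simp add: euclidean_ball_def y vec_scale_def vec_space_def)
  then show "y \<in> (\<Union>M\<in>multisets_of_size V d.
      euclidean_ball d (\<lambda>i. \<rho> * ((\<Sum>v\<in>#M. v i) / real d)) (\<rho> * (R / sqrt (real d) + \<eta>)))"
    using M by blast
qed

text \<open>
  Both sides are products over \<open>k < d\<close>, of \<open>(2l + k) / (k + 1)\<close> and of \<open>2 (l + k + 1) / (k + 1)\<close>,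
  and the inequality holds factor by factor.
\<close>

lemma binomial_double_le:
  assumes "1 \<le> l"
  shows "(2 * l + d - 1) choose d \<le> 2 ^ d * ((l + d) choose d)"
proof (induction d)
  case 0
  show ?case by simp
next
  case (Suc k)
  have "Suc k * ((2 * l + Suc k - 1) choose Suc k) = (2 * l + k) * ((2 * l + k - 1) choose k)"
    using Suc_times_binomial[of k "2 * l + k - 1"] assms by simp
  also have "\<dots> \<le> (2 * Suc (l + k)) * (2 ^ k * ((l + k) choose k))"
    by (intro mult_mono Suc.IH) auto
  also have "\<dots> = 2 ^ Suc k * (Suc (l + k) * ((l + k) choose k))"
    by (simp only: power_Suc mult_ac)
  also have "\<dots> = Suc k * (2 ^ Suc k * ((l + Suc k) choose Suc k))"
    by (simp only: Suc_times_binomial[symmetric] add_Suc_right mult_ac)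
  finally show ?case
    by (simp only: mult_le_cancel1)
qed

lemma card_symmetric_multisets_le:
  assumes "1 \<le> l"
  shows "card (multisets_of_size (f ` {1..l} \<union> g ` {1..l}) d) \<le> 2 ^ d * ((l + d) choose d)"
proof -
  let ?V = "f ` {1..l} \<union> g ` {1..l}"
  have "card ?V \<le> card (f ` {1..l}) + card (g ` {1..l})"
    by (rule card_Un_le)
  also have "\<dots> \<le> l + l"
    by (intro add_mono) (metis card_image_le card_atLeastAtMost diff_Suc_1 finite_atLeastAtMost)+
  finally have "card ?V + d - 1 \<le> 2 * l + d - 1" by simp
  then have "card (multisets_of_size ?V d) \<le> (2 * l + d - 1) choose d"
    by (simp add: card_multisets_of_size binomial_right_mono)
  also have "\<dots> \<le> 2 ^ d * ((l + d) choose d)"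
    by (rule binomial_double_le[OF assms])
  finally show ?thesis .
qed

lemma gaussian_measure_scaled_hull_le:
  assumes d: "1 \<le> d" and V: "V \<subseteq> vec_space d" "finite V" "V \<noteq> {}"
    and R: "\<And>v. v \<in> V \<Longrightarrow> L2_set v {..<d} \<le> R" and "0 \<le> \<rho>" "0 \<le> \<eta>"
  shows "measure (gaussian_measure d)
      (vec_scale d \<rho> ` minkowski_sum d (convex_hull d V) (vec_scale d \<eta> ` unit_ball d))
    \<le> real (card (multisets_of_size V d)) * (exp (1/2) * \<rho> * (R + \<eta> * sqrt (real d)) / real d) ^ d"
proof -
  interpret prob_space "gaussian_measure d" by (rule prob_space_gaussian_measure)
  let ?A = "vec_scale d \<rho> ` minkowski_sum d (convex_hull d V) (vec_scale d \<eta> ` unit_ball d)"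
  let ?s = "\<rho> * (R / sqrt (real d) + \<eta>)"
  let ?B = "\<lambda>M. euclidean_ball d (\<lambda>i. \<rho> * ((\<Sum>v\<in>#M. v i) / real d)) ?s"
  let ?I = "multisets_of_size V d"
  have fin: "finite ?I" using V by blast
  obtain w where "w \<in> V" using V by blast
  then have "0 \<le> R" using R[of w] L2_set_nonneg[of w "{..<d}"] by linarith
  then have s: "0 \<le> ?s" using assms by simp
  have "measure (gaussian_measure d) ?A \<le> measure (gaussian_measure d) (\<Union>M\<in>?I. ?B M)"
    using scaled_minkowski_sum_covered[OF V(1) R d] assms fin
    by (intro finite_measure_mono sets.finite_UN euclidean_ball_measurable) auto
  also have "\<dots> \<le> (\<Sum>M\<in>?I. measure (gaussian_measure d) (?B M))"
    using fin by (intro finite_measure_subadditive_finite) (auto simp: euclidean_ball_measurable)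
  also have "\<dots> \<le> (\<Sum>M\<in>?I. (exp (1/2) * ?s / sqrt (real d)) ^ d)"
    by (intro sum_mono gaussian_measure_ball_le d s)
  also have "exp (1/2) * ?s / sqrt (real d) = exp (1/2) * \<rho> * (R + \<eta> * sqrt (real d)) / real d"
    using d by (simp add: field_simps)
  finally show ?thesis by simp
qed

theorem lemma4p1:
  "\<exists>C::real. 0 < C \<and>
    (\<forall>(d::nat) (l::nat) (x :: nat \<Rightarrow> nat \<Rightarrow> real).
      1 \<le> d \<longrightarrow> 1 \<le> l \<longrightarrow> (\<forall>i\<in>{1..l}. x i \<in> vec_space d) \<longrightarrow>
      (let P = convex_hull d (x ` {1..l} \<union> (\<lambda>i. vec_scale d (-1) (x i)) ` {1..l});
           R = Max ((\<lambda>i. L2_set (x i) {..<d}) ` {1..l})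
       in \<forall>(\<rho>::real) (\<eta>::real). 1 \<le> \<rho> \<longrightarrow> 0 \<le> \<eta> \<longrightarrow>
            measure (gaussian_measure d)
              (vec_scale d \<rho> ` minkowski_sum d P (vec_scale d \<eta> ` unit_ball d))
            \<le> real ((l + d) choose d) * (C * \<rho> * (R + \<eta> * sqrt (real d)) / real d) ^ d))"
proof (intro exI[of _ "2 * exp (1/2)"] conjI allI impI)
  show "0 < 2 * exp (1/2 :: real)" by simp
  fix d l :: nat and x :: "nat \<Rightarrow> nat \<Rightarrow> real"
  assume d: "1 \<le> d" and l: "1 \<le> l" and x: "\<forall>i\<in>{1..l}. x i \<in> vec_space d"
  define V where "V = x ` {1..l} \<union> (\<lambda>i. vec_scale d (-1) (x i)) ` {1..l}"
  define R where "R = Max ((\<lambda>i. L2_set (x i) {..<d}) ` {1..l})"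
  have "vec_scale d c y \<in> vec_space d" for c y
    by (simp add: vec_scale_def vec_space_def)
  then have V: "V \<subseteq> vec_space d" "finite V" "V \<noteq> {}"
    using x l by (auto simp: V_def)
  have xR: "L2_set (x i) {..<d} \<le> R" if "i \<in> {1..l}" for i
    unfolding R_def using that by (intro Max_ge) auto
  have neg: "L2_set (vec_scale d (-1) (x i)) {..<d} = L2_set (x i) {..<d}" for i
    by (simp add: L2_set_def vec_scale_def)
  have VR: "L2_set v {..<d} \<le> R" if "v \<in> V" for v
    using that by (auto simp: V_def neg xR)
  have R0: "0 \<le> R"
    using L2_set_nonneg xR[of 1] by (rule order_trans) (use l in simp)
  have "measure (gaussian_measure d)
      (vec_scale d \<rho> ` minkowski_sum d (convex_hull d V) (vec_scale d \<eta> ` unit_ball d))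
    \<le> real ((l + d) choose d) * (2 * exp (1/2) * \<rho> * (R + \<eta> * sqrt (real d)) / real d) ^ d"
    if "1 \<le> \<rho>" "0 \<le> \<eta>" for \<rho> \<eta> :: real
  proof -
    let ?q = "exp (1/2) * \<rho> * (R + \<eta> * sqrt (real d)) / real d"
    have "card (multisets_of_size V d) \<le> 2 ^ d * ((l + d) choose d)"
      unfolding V_def by (rule card_symmetric_multisets_le[OF l])
    then have card: "real (card (multisets_of_size V d)) \<le> 2 ^ d * real ((l + d) choose d)"
      by (metis of_nat_le_iff of_nat_mult of_nat_numeral of_nat_power)
    have "measure (gaussian_measure d)
        (vec_scale d \<rho> ` minkowski_sum d (convex_hull d V) (vec_scale d \<eta> ` unit_ball d))
      \<le> real (card (multisets_of_size V d)) * ?q ^ d"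
      using that by (intro gaussian_measure_scaled_hull_le d V VR) auto
    also have "\<dots> \<le> (2 ^ d * real ((l + d) choose d)) * ?q ^ d"
      using that R0 by (intro mult_right_mono card) auto
    also have "\<dots> = real ((l + d) choose d) * (2 * ?q) ^ d"
      by (simp only: power_mult_distrib mult_ac)
    also have "2 * ?q = 2 * exp (1/2) * \<rho> * (R + \<eta> * sqrt (real d)) / real d"
      by simp
    finally show ?thesis .
  qed
  then show "let P = convex_hull d (x ` {1..l} \<union> (\<lambda>i. vec_scale d (-1) (x i)) ` {1..l});
           R = Max ((\<lambda>i. L2_set (x i) {..<d}) ` {1..l})
       in \<forall>(\<rho>::real) (\<eta>::real). 1 \<le> \<rho> \<longrightarrow> 0 \<le> \<eta> \<longrightarrow>
            measure (gaussian_measure d)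
              (vec_scale d \<rho> ` minkowski_sum d P (vec_scale d \<eta> ` unit_ball d))
            \<le> real ((l + d) choose d) * (2 * exp (1/2) * \<rho> * (R + \<eta> * sqrt (real d)) / real d) ^ d"
    by (simp add: Let_def V_def R_def)
qed

end
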